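(* Let $q \in (0,1)$ and let $f \in \mathcal{SL}^*_q$ have the form $f(z) = z+\sum_{n=2}^{\infty} a_n z^n$. Then the third Hankel determinant $H_3(1) = a_3(a_2 a_4-a_3^2)-a_4(a_4-a_2 a_3)+a_5(a_3-a_2^2)$ of $f$ satisfies $$|H_3(1)| \leq \frac{(1+q)^2}{16\, q^2 (1+q+q^2)^2}.$$
   Context: $\mathbb{D}$ is the open unit disk in $\mathbb{C}$, and $\mathcal{A}$ is the class of analytic functions on $\mathbb{D}$ of the form $f(z) = z+\sum_{n=2}^{\infty} a_n z^n$. Subordination: for analytic functions $g,h$ on $\mathbb{D}$, $g \prec h$ means there is a Schwarz function $\omega$ (analytic on $\mathbb{D}$, $\omega(0)=0$, $|\omega(z)|<1$) with $g(z)=h(\omega(z))$ for all $z\in\mathbb{D}$. For $q\in(0,1)$ the $q$-derivative of $f$ is $(D_q f)(z) = \dfrac{f(z)-f(qz)}{(1-q)z}$ for $z\neq 0$ and $(D_q f)(0)=f'(0)$. For $f\in\mathcal{A}$ this gives $(D_q f)(z)=1+\sum_{n=2}^\infty [n]_q a_n z^{n-1}$ with $[n]_q = 1+q+\cdots+q^{n-1}$. The class $\mathcal{SL}^*_q$ is $$\mathcal{SL}^*_q := \left\{ f\in\mathcal{A} : \frac{z(D_q f)(z)}{f(z)} \prec \sqrt{\frac{2(1+z)}{2+(1-q)z}},\ z\in\mathbb{D}\right\},$$ where the square root is the branch taking the value $1$ at $z=0$, and the quotient $z(D_q f)(z)/f(z)$ is understood to take the value $1$ at $z=0$. *)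

theory Defs
  imports "HOL-Complex_Analysis.Complex_Analysis"
begin

text \<open>
  Functions on the open unit disk are total functions on the complex numbers, of which only
  the values on the disk matter.
\<close>

abbreviation unit_disk :: "complex set" where
  "unit_disk \<equiv> ball 0 1"

definition has_normalized_expansion :: "(complex \<Rightarrow> complex) \<Rightarrow> (nat \<Rightarrow> complex) \<Rightarrow> bool" where
  "has_normalized_expansion f a \<longleftrightarrow>
     (\<forall>z\<in>unit_disk. (\<lambda>n. a (n + 2) * z ^ (n + 2)) sums (f z - z))"

definition class_A :: "(complex \<Rightarrow> complex) set" where
  "class_A = {f. f holomorphic_on unit_disk \<and> (\<exists>a. has_normalized_expansion f a)}"

definition schwarz_function :: "(complex \<Rightarrow> complex) \<Rightarrow> bool" where
  "schwarz_function \<omega> \<longleftrightarrow>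
     \<omega> holomorphic_on unit_disk \<and> \<omega> 0 = 0 \<and> (\<forall>z\<in>unit_disk. norm (\<omega> z) < 1)"

definition subordinate :: "(complex \<Rightarrow> complex) \<Rightarrow> (complex \<Rightarrow> complex) \<Rightarrow> bool" where
  "subordinate g h \<longleftrightarrow>
     g holomorphic_on unit_disk \<and> h holomorphic_on unit_disk \<and>
     (\<exists>\<omega>. schwarz_function \<omega> \<and> (\<forall>z\<in>unit_disk. g z = h (\<omega> z)))"

definition q_deriv :: "real \<Rightarrow> (complex \<Rightarrow> complex) \<Rightarrow> complex \<Rightarrow> complex" where
  "q_deriv q f z =
     (if z = 0 then deriv f 0
      else (f z - f (of_real q * z)) / ((1 - of_real q) * z))"

text \<open>
  For \<open>0 < q < 1\<close> and \<open>z\<close> in the disk the radicand lies in the right half plane, so the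
  principal square root is the analytic branch with value \<open>1\<close> at \<open>0\<close>; see the lemmas below.
\<close>

definition sl_majorant :: "real \<Rightarrow> complex \<Rightarrow> complex" where
  "sl_majorant q z = csqrt (2 * (1 + z) / (2 + (1 - of_real q) * z))"

lemma sl_majorant_0: "sl_majorant q 0 = 1"
  by (simp add: sl_majorant_def)

lemma sl_radicand_Re_pos:
  assumes "0 < q" "q < 1" "z \<in> unit_disk"
  shows "Re (2 * (1 + z) / (2 + (1 - of_real q) * z)) > 0"
proof -
  define x y where "x = Re z" and "y = Im z"
  have "norm z < 1" using assms by simp
  then have "(norm z)\<^sup>2 < 1" by (simp add: power_less_one_iff abs_square_less_1)
  then have xy: "x\<^sup>2 + y\<^sup>2 < 1" by (simp add: cmod_power2 x_def y_def)
  have x: "x > -1" using abs_Re_le_cmod[of z] \<open>norm z < 1\<close> by (simp add: x_def)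
  have "2 + (1 - q) * x = (1 - q) * (1 + x) + (1 + q)" by (simp add: algebra_simps)
  also have "\<dots> > 0" using assms x by (intro add_nonneg_pos) auto
  finally have "2 + (1 - q) * x > 0" .
  then have d: "(2 + (1 - q) * x)\<^sup>2 + ((1 - q) * y)\<^sup>2 > 0"
    by (simp add: add_pos_nonneg)
  have "(1 + x) * (2 + (1 - q) * x) + (1 - q) * y\<^sup>2
        = (1 + x) * (1 + q) + (1 - q) * ((1 + x)\<^sup>2 + y\<^sup>2)"
    by (simp add: algebra_simps power2_eq_square)
  also have "\<dots> > 0" using assms x by (intro add_pos_nonneg) auto
  finally have n: "(1 + x) * (2 + (1 - q) * x) + (1 - q) * y\<^sup>2 > 0" .
  have "Re (2 * (1 + z) / (2 + (1 - of_real q) * z))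
        = 2 * ((1 + x) * (2 + (1 - q) * x) + (1 - q) * y\<^sup>2)
          / ((2 + (1 - q) * x)\<^sup>2 + ((1 - q) * y)\<^sup>2)"
    by (simp add: Re_divide x_def y_def power2_eq_square algebra_simps)
  then show ?thesis using n d by simp
qed

lemma sl_majorant_holomorphic:
  assumes "0 < q" "q < 1"
  shows "sl_majorant q holomorphic_on unit_disk"
proof -
  have nz: "2 + (1 - of_real q) * z \<noteq> 0" if "z \<in> unit_disk" for z :: complex
    using sl_radicand_Re_pos[OF assms that] by auto
  have "2 * (1 + z) / (2 + (1 - of_real q) * z) \<notin> \<real>\<^sub>\<le>\<^sub>0" if "z \<in> unit_disk" for z
    using sl_radicand_Re_pos[OF assms that] by (auto simp: complex_nonpos_Reals_iff)
  then show ?thesis unfolding sl_majorant_def[abs_def]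
    using nz by (intro holomorphic_on_csqrt' holomorphic_intros) auto
qed

text \<open>
  The subordination forces \<open>f z \<noteq> 0\<close> for \<open>z \<noteq> 0\<close> in the disk: where \<open>f\<close> vanishes, the quotient
  is \<open>0\<close> by the convention on division, whereas \<open>sl_majorant q\<close> has no zero in the disk.
\<close>

definition class_SL :: "real \<Rightarrow> (complex \<Rightarrow> complex) set" where
  "class_SL q =
     {f \<in> class_A.
        subordinate (\<lambda>z. if z = 0 then 1 else z * q_deriv q f z / f z) (sl_majorant q)}"

definition hankel_3_1 :: "(nat \<Rightarrow> complex) \<Rightarrow> complex" where
  "hankel_3_1 a =
     a 3 * (a 2 * a 4 - (a 3)\<^sup>2) - a 4 * (a 4 - a 2 * a 3) + a 5 * (a 3 - (a 2)\<^sup>2)"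

end

theory Submission imports Defs
begin

text \<open>
  Let \<open>p(z) = z (D\<^sub>q f)(z) / f(z)\<close>. The functional equation \<open>f(z) - f(qz) = (1 - q) p(z) f(z)\<close>
  gives a recursion for the coefficients \<open>h\<^sub>n\<close> of \<open>z / f(z)\<close>, and \<open>H\<^sub>3(1) = h\<^sub>2 h\<^sub>4 - h\<^sub>3\<^sup>2\<close>.
  In terms of the coefficients \<open>c\<^sub>n\<close> of the Schwarz function this is a multiple of
  \<open>\<rho> v\<^sub>2 v\<^sub>4 - v\<^sub>3\<^sup>2\<close> with \<open>v\<^sub>n = c\<^sub>n + \<dots>\<close>, and the claim becomes \<open>|\<rho> v\<^sub>2 v\<^sub>4 - v\<^sub>3\<^sup>2| \<le> 1\<close>, with
  equality for \<open>\<omega>(z) = z\<^sup>3\<close>. Expressing the \<open>c\<^sub>n\<close> by the Schur parameters \<open>c, x, y, w\<close> and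
  applying the triangle inequality to the expansion in powers of \<open>y\<close> leaves two polynomial
  inequalities in \<open>|c|\<^sup>2\<close> and \<open>|x|\<close>, in which only crude bounds on the \<open>q\<close>-dependent constants
  are needed.
\<close>

unbundle no vec_syntax

section \<open>Schur parameters\<close>

text \<open>If \<open>\<phi>\<close> reaches modulus 1 in the disk, the maximum principle makes it
  constant and \<open>\<psi> = 0\<close> works. Otherwise the Moebius map sending
  \<open>\<phi> 0\<close> to 0 turns \<open>\<phi>\<close> into a self-map of the disk fixing 0, and
  the Schwarz lemma bounds its quotient by z. Clearing the Moebius denominator lets one identity
  cover both cases.\<close>

lemma schur_step:
  assumes holo: "\<phi> holomorphic_on unit_disk"
    and bound: "\<And>z. z \<in> unit_disk \<Longrightarrow> norm (\<phi> z) \<le> 1"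
  obtains \<psi> where "\<psi> holomorphic_on unit_disk" "\<And>z. z \<in> unit_disk \<Longrightarrow> norm (\<psi> z) \<le> 1"
    "\<And>z. z \<in> unit_disk \<Longrightarrow> \<phi> z = \<phi> 0 + z * \<psi> z * (1 - cnj (\<phi> 0) * \<phi> z)"
proof (cases "\<exists>z\<in>unit_disk. norm (\<phi> z) = 1")
  case True
  then obtain z0 where z0: "z0 \<in> unit_disk" "norm (\<phi> z0) = 1" by blast
  have "\<phi> constant_on unit_disk"
    by (rule maximum_modulus_principle[of \<phi> unit_disk unit_disk z0])
       (use holo bound z0 in auto)
  then have const: "\<phi> z = \<phi> 0" if "z \<in> unit_disk" for z
    using that unfolding constant_on_def by (metis centre_in_ball zero_less_one)
  show ?thesis
  proof (rule that[of "\<lambda>_. 0"])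
    show "\<phi> z = \<phi> 0 + z * 0 * (1 - cnj (\<phi> 0) * \<phi> z)" if "z \<in> unit_disk" for z
      using const[OF that] by (simp only: mult_zero_right mult_zero_left add_0_right)
  qed (simp_all only: holomorphic_on_const norm_zero zero_le_one)
next
  case False
  define a where "a = \<phi> 0"
  have lt: "norm (\<phi> z) < 1" if "norm z < 1" for z
  proof -
    have "z \<in> unit_disk" using that by simp
    then show ?thesis using False bound[of z] by (metis less_le)
  qed
  then have a: "norm a < 1" by (simp add: a_def)
  define g where "g = (\<lambda>z. Moebius_function 0 a (\<phi> z))"
  have "Moebius_function 0 a \<circ> \<phi> holomorphic_on unit_disk"
    by (rule holomorphic_on_compose_gen[OF holo Moebius_function_holomorphic[OF a]])
       (use lt in auto)
  then have gh: "g holomorphic_on unit_disk" by (simp add: g_def o_def)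
  have g0: "g 0 = 0" by (simp add: g_def a_def Moebius_function_eq_zero)
  have glt: "norm (g z) < 1" if "norm z < 1" for z
    using Moebius_function_norm_lt_1[OF a lt[OF that]] by (simp add: g_def)
  obtain h where h: "h holomorphic_on unit_disk" "\<And>z. norm z < 1 \<Longrightarrow> g z = z * h z"
    and h0: "deriv g 0 = h 0"
    using Schwarz3[OF gh g0] by metis
  show ?thesis
  proof (rule that[OF h(1)])
    fix z :: complex assume "z \<in> unit_disk"
    then have z: "norm z < 1" by simp
    \<comment> \<open>Away from 0 the Schwarz inequality is divided by |z|; at 0 the quotient takes
      the value g'(0), which the Schwarz lemma bounds separately.\<close>
    show "norm (h z) \<le> 1"
    proof (cases "z = 0")
      case True
      then show ?thesis using Schwarz_Lemma(2)[OF gh g0 glt z] h0 by simp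
    next
      case False
      have "norm z * norm (h z) \<le> norm z * 1"
        using Schwarz_Lemma(1)[OF gh g0 glt z] h(2)[OF z] by (simp add: norm_mult)
      then show ?thesis using False by simp
    qed
    have "norm (cnj a * \<phi> z) < 1 * 1"
      unfolding norm_mult using a lt[OF z] by (intro mult_strict_mono') auto
    then have "1 - cnj a * \<phi> z \<noteq> 0" by auto
    then have "\<phi> z - a = z * h z * (1 - cnj a * \<phi> z)"
      using h(2)[OF z] by (simp add: g_def Moebius_function_simple field_simps)
    then show "\<phi> z = \<phi> 0 + z * h z * (1 - cnj (\<phi> 0) * \<phi> z)"
      by (simp add: a_def algebra_simps)
  qed
qed

lemma has_fps_expansion_disk:
  assumes "\<phi> holomorphic_on unit_disk"
  shows "\<phi> has_fps_expansion fps_expansion \<phi> 0"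
  using assms by (intro has_fps_expansion_fps_expansion) auto

lemma fps_eq_on_disk:
  assumes "g has_fps_expansion G" "h has_fps_expansion H" "\<And>z. z \<in> unit_disk \<Longrightarrow> g z = h z"
  shows "G = H"
proof -
  have "eventually (\<lambda>z. z \<in> unit_disk) (nhds (0::complex))"
    by (intro eventually_nhds_in_open) auto
  then have "eventually (\<lambda>z. g z = h z) (nhds 0)"
    by eventually_elim (use assms(3) in auto)
  then have "h has_fps_expansion G"
    using assms(1) has_fps_expansion_cong by blast
  then show ?thesis using assms(2) fps_expansion_unique_complex by blast
qed

lemma schur_step_coeffs:
  assumes "\<phi> holomorphic_on unit_disk" "\<And>z. z \<in> unit_disk \<Longrightarrow> norm (\<phi> z) \<le> 1"
  obtains \<psi> where "\<psi> holomorphic_on unit_disk" "\<And>z. z \<in> unit_disk \<Longrightarrow> norm (\<psi> z) \<le> 1"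
    "fps_expansion \<phi> 0 = fps_const (\<phi> 0) +
       fps_X * fps_expansion \<psi> 0 * (1 - fps_const (cnj (\<phi> 0)) * fps_expansion \<phi> 0)"
proof -
  obtain \<psi> where \<psi>: "\<psi> holomorphic_on unit_disk" "\<And>z. z \<in> unit_disk \<Longrightarrow> norm (\<psi> z) \<le> 1"
    "\<And>z. z \<in> unit_disk \<Longrightarrow> \<phi> z = \<phi> 0 + z * \<psi> z * (1 - cnj (\<phi> 0) * \<phi> z)"
    using schur_step[OF assms] by blast
  note [fps_expansion_intros] = has_fps_expansion_disk[OF assms(1)] has_fps_expansion_disk[OF \<psi>(1)]
  have "(\<lambda>z. \<phi> 0 + z * \<psi> z * (1 - cnj (\<phi> 0) * \<phi> z)) has_fps_expansion fps_const (\<phi> 0) +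
       fps_X * fps_expansion \<psi> 0 * (1 - fps_const (cnj (\<phi> 0)) * fps_expansion \<phi> 0)"
    by (intro fps_expansion_intros)
  from fps_eq_on_disk[OF has_fps_expansion_disk[OF assms(1)] this \<psi>(3)]
  show ?thesis using that[OF \<psi>(1,2)] by blast
qed

text \<open>Four Schur steps \<open>\<omega>\<close>, \<open>\<phi>\<close>, \<open>\<psi>\<close>,
  \<open>\<theta>\<close>, \<open>\<eta>\<close>; the parameters are the values at 0 of the last
  four functions. Since \<open>\<omega> 0 = 0\<close>, the first step is plain division by
  z.\<close>

lemma schwarz_coeffs:
  assumes "schwarz_function \<omega>"
  obtains c x y w :: complex where
    "norm c \<le> 1" "norm x \<le> 1" "norm y \<le> 1" "norm w \<le> 1"
    "fps_nth (fps_expansion \<omega> 0) 1 = c"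
    "fps_nth (fps_expansion \<omega> 0) 2 = (1 - c * cnj c) * x"
    "fps_nth (fps_expansion \<omega> 0) 3 = (1 - c * cnj c) * ((1 - x * cnj x) * y - cnj c * x\<^sup>2)"
    "fps_nth (fps_expansion \<omega> 0) 4 = (1 - c * cnj c) *
       ((1 - x * cnj x) * ((1 - y * cnj y) * w - cnj x * y\<^sup>2)
        - 2 * cnj c * (1 - x * cnj x) * x * y + (cnj c)\<^sup>2 * x ^ 3)"
proof -
  have \<omega>: "\<omega> holomorphic_on unit_disk" "\<omega> 0 = 0" "\<And>z. z \<in> unit_disk \<Longrightarrow> norm (\<omega> z) \<le> 1"
    using assms by (auto simp: schwarz_function_def less_imp_le)
  have nth0: "fps_nth (fps_expansion g 0) 0 = g 0" for g by (simp add: fps_expansion_def)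
  obtain \<phi> where \<phi>: "\<phi> holomorphic_on unit_disk" "\<And>z. z \<in> unit_disk \<Longrightarrow> norm (\<phi> z) \<le> 1"
    and W0: "fps_expansion \<omega> 0 = fps_const (\<omega> 0) +
       fps_X * fps_expansion \<phi> 0 * (1 - fps_const (cnj (\<omega> 0)) * fps_expansion \<omega> 0)"
    using schur_step_coeffs[OF \<omega>(1,3)] by blast
  have W: "fps_expansion \<omega> 0 = fps_X * fps_expansion \<phi> 0"
    by (subst W0) (simp add: \<omega>(2))
  obtain \<psi> where \<psi>: "\<psi> holomorphic_on unit_disk" "\<And>z. z \<in> unit_disk \<Longrightarrow> norm (\<psi> z) \<le> 1"
    and P: "fps_expansion \<phi> 0 = fps_const (\<phi> 0) +
       fps_X * fps_expansion \<psi> 0 * (1 - fps_const (cnj (\<phi> 0)) * fps_expansion \<phi> 0)"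
    using schur_step_coeffs[OF \<phi>] by blast
  obtain \<theta> where \<theta>: "\<theta> holomorphic_on unit_disk" "\<And>z. z \<in> unit_disk \<Longrightarrow> norm (\<theta> z) \<le> 1"
    and Q: "fps_expansion \<psi> 0 = fps_const (\<psi> 0) +
       fps_X * fps_expansion \<theta> 0 * (1 - fps_const (cnj (\<psi> 0)) * fps_expansion \<psi> 0)"
    using schur_step_coeffs[OF \<psi>] by blast
  obtain \<eta> where \<eta>: "\<eta> holomorphic_on unit_disk" "\<And>z. z \<in> unit_disk \<Longrightarrow> norm (\<eta> z) \<le> 1"
    and R: "fps_expansion \<theta> 0 = fps_const (\<theta> 0) +
       fps_X * fps_expansion \<eta> 0 * (1 - fps_const (cnj (\<theta> 0)) * fps_expansion \<theta> 0)"
    using schur_step_coeffs[OF \<theta>] by blast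
  define W P Q R where "W = fps_expansion \<omega> 0" and "P = fps_expansion \<phi> 0"
    and "Q = fps_expansion \<psi> 0" and "R = fps_expansion \<theta> 0"
  \<comment> \<open>One Schur step on coefficients: the implicit relation between \<open>F\<close>
    and \<open>G\<close> is solved for the first four coefficients of \<open>F\<close>.\<close>
  have step: "F $ 0 = a" "F $ 1 = (1 - a * cnj a) * G $ 0"
    "F $ 2 = (1 - a * cnj a) * (G $ 1 - cnj a * (G $ 0)\<^sup>2)"
    "F $ 3 = (1 - a * cnj a) * (G $ 2 - 2 * cnj a * G $ 0 * G $ 1 + (cnj a)\<^sup>2 * (G $ 0) ^ 3)"
    if F: "F = fps_const a + fps_X * G * (1 - fps_const (cnj a) * F)" for F G :: "complex fps" and a
  proof -
    define K where "K = 1 - fps_const (cnj a) * F"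
    have K: "K $ n = (if n = 0 then 1 else 0) - cnj a * F $ n" for n
      by (simp add: K_def)
    \<comment> \<open>The factor \<open>fps_X\<close> shifts the index, so the right side involves
      only \<open>F $ 0\<close> to \<open>F $ n\<close> and the relation is a genuine
      recursion.\<close>
    have S: "F $ Suc n = (\<Sum>i=0..n. G $ i * K $ (n - i))" for n
    proof -
      have "F $ Suc n = (fps_const a + fps_X * (G * K)) $ Suc n"
        using F by (simp only: mult.assoc K_def)
      also have "\<dots> = (G * K) $ n" by simp
      finally show ?thesis by (simp only: fps_mult_nth)
    qed
    show 0: "F $ 0 = a" by (subst F) simp
    show 1: "F $ 1 = (1 - a * cnj a) * G $ 0"
      using S[of 0] by (simp add: 0 K algebra_simps)
    show 2: "F $ 2 = (1 - a * cnj a) * (G $ 1 - cnj a * (G $ 0)\<^sup>2)"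
    proof -
      have "F $ 2 = G $ 0 * (- cnj a * F $ 1) + G $ 1 * (1 - cnj a * a)"
        using S[of 1] by (simp add: 0 K numeral_2_eq_2)
      then show ?thesis unfolding 1 by algebra
    qed
    show 3: "F $ 3 = (1 - a * cnj a) * (G $ 2 - 2 * cnj a * G $ 0 * G $ 1 + (cnj a)\<^sup>2 * (G $ 0) ^ 3)"
    proof -
      have "F $ 3 = G $ 0 * (- cnj a * F $ 2) + G $ 1 * (- cnj a * F $ 1) + G $ 2 * (1 - cnj a * a)"
        using S[of 2] by (simp add: 0 K numeral_2_eq_2 numeral_3_eq_3)
      then show ?thesis unfolding 1 2 by algebra
    qed
  qed
  note sP = step[OF P] and sQ = step[OF Q] and sR = step[OF R]
  have sW: "W $ 1 = P $ 0" "W $ 2 = P $ 1" "W $ 3 = P $ 2" "W $ 4 = P $ 3"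
    by (simp_all add: W_def P_def W numeral_eq_Suc)
  show ?thesis
  proof (rule that[of "\<phi> 0" "\<psi> 0" "\<theta> 0" "\<eta> 0"], goal_cases)
    case 5 then show ?case using sW sP by (simp add: W_def P_def)
  next
    case 6 then show ?case using sW sP sQ by (simp add: W_def P_def)
  next
    case 7 then show ?case using sW sP sQ sR by (simp add: W_def P_def)
  next
    case 8
    have "W $ 4 = (1 - \<phi> 0 * cnj (\<phi> 0)) * (Q $ 2 - 2 * cnj (\<phi> 0) * \<psi> 0 * Q $ 1 + (cnj (\<phi> 0))\<^sup>2 * \<psi> 0 ^ 3)"
      using sW sP sQ by (simp add: W_def P_def Q_def)
    then show ?case using sQ sR nth0[of \<eta>] by (simp add: W_def Q_def R_def)
  qed (use \<phi>(2) \<psi>(2) \<theta>(2) \<eta>(2) sW in \<open>auto simp: W_def\<close>)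
qed

section \<open>The functional equation\<close>

text \<open>The expansion starts at index 2 and leaves \<open>a 0\<close> and \<open>a 1\<close>
  unconstrained, so \<open>F\<close> replaces them by 0 and 1.\<close>

lemma has_fps_expansion_normalized:
  assumes "has_normalized_expansion f a"
  defines "F \<equiv> Abs_fps (\<lambda>n. if n = 0 then 0 else if n = 1 then 1 else a n)"
  shows "f has_fps_expansion F"
proof -
  have sums: "(\<lambda>n. fps_nth F n * z ^ n) sums f z" if "norm z < 1" for z
  proof -
    have "(\<lambda>n. a (n + 2) * z ^ (n + 2)) sums (f z - z)"
      using assms that by (simp add: has_normalized_expansion_def)
    then have "(\<lambda>n. fps_nth F (n + 2) * z ^ (n + 2)) sums (f z - (\<Sum>n<2. fps_nth F n * z ^ n))"
      by (simp add: F_def numeral_2_eq_2)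
    then show ?thesis using sums_iff_shift'[of "\<lambda>n. fps_nth F n * z ^ n" 2] by blast
  qed
  have "eventually (\<lambda>z. z \<in> unit_disk) (nhds (0::complex))"
    by (intro eventually_nhds_in_open) auto
  then have "eventually (\<lambda>z. (\<lambda>n. fps_nth F n * z ^ n) sums f z) (nhds 0)"
    by eventually_elim (use sums in auto)
  then show "f has_fps_expansion F" by (rule has_fps_expansionI)
qed

lemma has_fps_expansion_dilation:
  fixes f :: "complex \<Rightarrow> complex"
  assumes "f has_fps_expansion F"
  shows "(\<lambda>z. f (k * z)) has_fps_expansion fps_compose F (fps_const k * fps_X)"
proof -
  have "(f \<circ> (\<lambda>z. k * z)) has_fps_expansion fps_compose F (fps_const k * fps_X)"
    by (intro has_fps_expansion_compose assms fps_expansion_intros) simp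
  then show ?thesis by (simp add: o_def)
qed

text \<open>Squaring removes the root, and clearing denominators turns both the subordination and
  the definition of the q-derivative into identities that can be compared coefficientwise.\<close>

lemma class_SL_functional_equation:
  assumes q: "0 < q" "q < 1" and f: "f \<in> class_SL q"
  obtains g \<omega> where "g holomorphic_on unit_disk" "schwarz_function \<omega>" "g 0 = 1"
    "\<And>z. z \<in> unit_disk \<Longrightarrow> (g z)\<^sup>2 * (2 + (1 - of_real q) * \<omega> z) = 2 * (1 + \<omega> z)"
    "\<And>z. z \<in> unit_disk \<Longrightarrow> f z - f (of_real q * z) = (1 - of_real q) * g z * f z"
proof -
  define g where "g = (\<lambda>z. if z = 0 then 1 else z * q_deriv q f z / f z)"
  obtain \<omega> where g: "g holomorphic_on unit_disk" and \<omega>: "schwarz_function \<omega>"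
    and g\<omega>: "\<And>z. z \<in> unit_disk \<Longrightarrow> g z = sl_majorant q (\<omega> z)"
    using f by (auto simp: class_SL_def subordinate_def g_def)
  obtain a where "has_normalized_expansion f a"
    using f by (auto simp: class_SL_def class_A_def)
  then have f0: "f 0 = 0"
    using has_fps_expansion_imp_0_eq_fps_nth_0[OF has_fps_expansion_normalized] by auto
  show ?thesis
  proof (rule that[OF g \<omega>])
    show "g 0 = 1" by (simp add: g_def)
    fix z :: complex assume z: "z \<in> unit_disk"
    have w: "\<omega> z \<in> unit_disk" using \<omega> z by (simp add: schwarz_function_def)
    define N D where "N = 2 * (1 + \<omega> z)" and "D = 2 + (1 - of_real q) * \<omega> z"
    have pos: "Re (N / D) > 0"
      unfolding N_def D_def by (rule sl_radicand_Re_pos[OF q w])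
    then have D0: "D \<noteq> 0" by auto
    have g2: "(g z)\<^sup>2 = N / D"
      by (simp add: g\<omega>[OF z] sl_majorant_def N_def D_def)
    then show "(g z)\<^sup>2 * (2 + (1 - of_real q) * \<omega> z) = 2 * (1 + \<omega> z)"
      using D0 by (simp add: N_def D_def)
    have gnz: "g z \<noteq> 0" using g2 pos by auto
    show "f z - f (of_real q * z) = (1 - of_real q) * g z * f z"
    proof (cases "z = 0")
      case True
      then show ?thesis by (simp add: f0)
    next
      case False
      have "of_real q \<noteq> (1 :: complex)" using q by auto
      \<comment> \<open>Division by zero yields 0, so a zero of \<open>f\<close> here would force
        \<open>g z = 0\<close>, against the positive real part of
        \<open>(g z)\<^sup>2\<close>.\<close>
      moreover have "f z \<noteq> 0" using gnz False by (auto simp: g_def)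
      ultimately show ?thesis using False by (simp add: g_def q_deriv_def)
    qed
  qed
qed

text \<open>Coefficients are compared up to order 5 in the equation for \<open>f\<close> and up to
  order 4 in the one for \<open>g\<close>. The \<open>g1\<close>, ..., \<open>g4\<close> stay
  implicit here; they are solved for in \<open>hankel_reduction\<close>.\<close>

lemma class_SL_coeff_recurrences:
  assumes q: "0 < q" "q < 1" and f: "f \<in> class_SL q" and a: "has_normalized_expansion f a"
  defines "p \<equiv> complex_of_real q"
  obtains \<omega> g1 g2 g3 g4 c1 c2 c3 c4 where "schwarz_function \<omega>"
    "c1 = fps_expansion \<omega> 0 $ 1" "c2 = fps_expansion \<omega> 0 $ 2"
    "c3 = fps_expansion \<omega> 0 $ 3" "c4 = fps_expansion \<omega> 0 $ 4"
    "(1 + p) * a 2 = a 2 + g1"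
    "(1 + p + p\<^sup>2) * a 3 = a 3 + g1 * a 2 + g2"
    "(1 + p) * (1 + p\<^sup>2) * a 4 = a 4 + g1 * a 3 + g2 * a 2 + g3"
    "(1 + p + p\<^sup>2 + p ^ 3 + p ^ 4) * a 5 = a 5 + g1 * a 4 + g2 * a 3 + g3 * a 2 + g4"
    "2 * (2 * g1) + (1 - p) * c1 = 2 * c1"
    "2 * (2 * g2 + g1\<^sup>2) + (1 - p) * (c1 * (2 * g1) + c2) = 2 * c2"
    "2 * (2 * g3 + 2 * g1 * g2) + (1 - p) * (c1 * (2 * g2 + g1\<^sup>2) + c2 * (2 * g1) + c3) = 2 * c3"
    "2 * (2 * g4 + 2 * g1 * g3 + g2\<^sup>2)
        + (1 - p) * (c1 * (2 * g3 + 2 * g1 * g2) + c2 * (2 * g2 + g1\<^sup>2) + c3 * (2 * g1) + c4) = 2 * c4"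
proof -
  obtain g \<omega> where g: "g holomorphic_on unit_disk" and \<omega>: "schwarz_function \<omega>" and g0: "g 0 = 1"
    and eq1: "\<And>z. z \<in> unit_disk \<Longrightarrow> (g z)\<^sup>2 * (2 + (1 - p) * \<omega> z) = 2 * (1 + \<omega> z)"
    and eq2: "\<And>z. z \<in> unit_disk \<Longrightarrow> f z - f (p * z) = (1 - p) * g z * f z"
    using class_SL_functional_equation[OF q f] unfolding p_def by blast
  have \<omega>h: "\<omega> holomorphic_on unit_disk" and \<omega>0: "\<omega> 0 = 0"
    using \<omega> by (simp_all add: schwarz_function_def)
  define F where "F = Abs_fps (\<lambda>n. if n = 0 then 0 else if n = 1 then 1 else a n)"
  define G W where "G = fps_expansion g 0" and "W = fps_expansion \<omega> 0"
  have exp: "f has_fps_expansion F" "g has_fps_expansion G" "\<omega> has_fps_expansion W"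
    unfolding F_def G_def W_def
    using has_fps_expansion_normalized[OF a] has_fps_expansion_disk g \<omega>h by auto
  have G0: "G $ 0 = 1" and W0: "W $ 0 = 0"
    using has_fps_expansion_imp_0_eq_fps_nth_0[OF exp(2)]
      has_fps_expansion_imp_0_eq_fps_nth_0[OF exp(3)] g0 \<omega>0 by simp_all
  have "F - fps_compose F (fps_const p * fps_X) = fps_const (1 - p) * G * F"
  proof (rule fps_eq_on_disk[OF _ _ eq2])
    show "(\<lambda>z. f z - f (p * z)) has_fps_expansion F - fps_compose F (fps_const p * fps_X)"
      by (rule has_fps_expansion_diff[OF exp(1) has_fps_expansion_dilation[OF exp(1)]])
    show "(\<lambda>z. (1 - p) * g z * f z) has_fps_expansion fps_const (1 - p) * G * F"
      by (intro has_fps_expansion_mult has_fps_expansion_const exp)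
  qed
  then have FG: "(F - fps_compose F (fps_const p * fps_X)) $ n = (fps_const (1 - p) * (G * F)) $ n" for n
    by (simp only: mult.assoc)
  \<comment> \<open>The dilation z -> pz multiplies the n-th coefficient by p^n.\<close>
  have S: "(1 - p ^ n) * F $ n = (1 - p) * (\<Sum>i=0..n. G $ i * F $ (n - i))" for n
  proof -
    have "F $ n - p ^ n * F $ n = (1 - p) * (G * F) $ n"
      using FG[of n] by (simp only: fps_sub_nth fps_nth_compose_linear fps_mult_left_const_nth)
    then show ?thesis by (simp only: fps_mult_nth left_diff_distrib mult_1)
  qed
  \<comment> \<open>Cancelling 1 - p from 1 - p^n leaves the q-number [n]_q on the left of each
    recurrence; [4]_q is written in factored form.\<close>
  have p1: "1 - p \<noteq> 0" using q by (simp add: p_def)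
  have sums: "sum h {0..1} = h 0 + h 1" "sum h {0..2} = h 0 + h 1 + h 2" "sum h {0..3} = h 0 + h 1 + h 2 + h 3"
    "sum h {0..4} = h 0 + h 1 + h 2 + h 3 + h 4" "sum h {0..5} = h 0 + h 1 + h 2 + h 3 + h 4 + h 5"
    for h :: "nat \<Rightarrow> complex"
    by (simp_all add: numeral_eq_Suc)
  have "(1 - p ^ 2) * a 2 = (1 - p) * (a 2 + G $ 1)"
    using S[of 2] by (simp add: sums F_def G0)
  then have "(1 - p) * ((1 + p) * a 2) = (1 - p) * (a 2 + G $ 1)" by algebra
  then have a2: "(1 + p) * a 2 = a 2 + G $ 1"
    using mult_left_cancel[OF p1] by blast
  have "(1 - p ^ 3) * a 3 = (1 - p) * (a 3 + G $ 1 * a 2 + G $ 2)"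
    using S[of 3] by (simp add: sums F_def G0)
  then have "(1 - p) * ((1 + p + p\<^sup>2) * a 3) = (1 - p) * (a 3 + G $ 1 * a 2 + G $ 2)" by algebra
  then have a3: "(1 + p + p\<^sup>2) * a 3 = a 3 + G $ 1 * a 2 + G $ 2"
    using mult_left_cancel[OF p1] by blast
  have "(1 - p ^ 4) * a 4 = (1 - p) * (a 4 + G $ 1 * a 3 + G $ 2 * a 2 + G $ 3)"
    using S[of 4] by (simp add: sums F_def G0)
  then have "(1 - p) * ((1 + p) * (1 + p\<^sup>2) * a 4) = (1 - p) * (a 4 + G $ 1 * a 3 + G $ 2 * a 2 + G $ 3)" by algebra
  then have a4: "(1 + p) * (1 + p\<^sup>2) * a 4 = a 4 + G $ 1 * a 3 + G $ 2 * a 2 + G $ 3"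
    using mult_left_cancel[OF p1] by blast
  have "(1 - p ^ 5) * a 5 = (1 - p) * (a 5 + G $ 1 * a 4 + G $ 2 * a 3 + G $ 3 * a 2 + G $ 4)"
    using S[of 5] by (simp add: sums F_def G0)
  then have "(1 - p) * ((1 + p + p\<^sup>2 + p ^ 3 + p ^ 4) * a 5) = (1 - p) * (a 5 + G $ 1 * a 4 + G $ 2 * a 3 + G $ 3 * a 2 + G $ 4)" by algebra
  then have a5: "(1 + p + p\<^sup>2 + p ^ 3 + p ^ 4) * a 5 = a 5 + G $ 1 * a 4 + G $ 2 * a 3 + G $ 3 * a 2 + G $ 4"
    using mult_left_cancel[OF p1] by blast
  have E: "G\<^sup>2 * (fps_const 2 + fps_const (1 - p) * W) = fps_const 2 * (1 + W)"
  proof (rule fps_eq_on_disk[OF _ _ eq1])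
    show "(\<lambda>z. (g z)\<^sup>2 * (2 + (1 - p) * \<omega> z)) has_fps_expansion G\<^sup>2 * (fps_const 2 + fps_const (1 - p) * W)"
      by (intro has_fps_expansion_power has_fps_expansion_mult has_fps_expansion_add has_fps_expansion_const exp)
    show "(\<lambda>z. 2 * (1 + \<omega> z)) has_fps_expansion fps_const 2 * (1 + W)"
      by (intro has_fps_expansion_mult has_fps_expansion_add has_fps_expansion_const has_fps_expansion_1 exp)
  qed
  \<comment> \<open>With the square treated as a single series, the second relation becomes linear
    in \<open>H\<close>.\<close>
  define H where "H = G\<^sup>2"
  have Hn: "H $ n = (\<Sum>i=0..n. G $ i * G $ (n - i))" for n
    by (simp add: H_def power2_eq_square fps_mult_nth)
  have H: "H $ 0 = 1" "H $ 1 = 2 * G $ 1" "H $ 2 = 2 * G $ 2 + (G $ 1)\<^sup>2"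
    "H $ 3 = 2 * G $ 3 + 2 * G $ 1 * G $ 2" "H $ 4 = 2 * G $ 4 + 2 * G $ 1 * G $ 3 + (G $ 2)\<^sup>2"
    by (simp_all add: Hn G0 sums power2_eq_square algebra_simps)
  have WH: "fps_const 2 * H + fps_const (1 - p) * (W * H) = fps_const 2 + fps_const 2 * W"
    using E by (simp only: H_def) algebra
  \<comment> \<open>The constant series 2 contributes only at index 0, hence
    \<open>n > 0\<close>.\<close>
  have T: "2 * H $ n + (1 - p) * (\<Sum>i=0..n. W $ i * H $ (n - i)) = 2 * W $ n" if "n > 0" for n
  proof -
    have "2 * H $ n + (1 - p) * (W * H) $ n = 2 * W $ n"
      using arg_cong[OF WH, of "\<lambda>K. K $ n"] that
      by (simp only: fps_add_nth fps_mult_left_const_nth) simp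
    then show ?thesis by (simp only: fps_mult_nth)
  qed
  show ?thesis
  proof (rule that[OF \<omega> refl refl refl refl a2 a3 a4 a5], unfold W_def[symmetric])
    show "2 * (2 * G $ 1) + (1 - p) * W $ 1 = 2 * W $ 1"
      using T[of 1] by (simp add: W0 H H(2)[simplified] sums)
    show "2 * (2 * G $ 2 + (G $ 1)\<^sup>2) + (1 - p) * (W $ 1 * (2 * G $ 1) + W $ 2) = 2 * W $ 2"
      using T[of 2] by (simp add: W0 H H(2)[simplified] sums)
    show "2 * (2 * G $ 3 + 2 * G $ 1 * G $ 2)
        + (1 - p) * (W $ 1 * (2 * G $ 2 + (G $ 1)\<^sup>2) + W $ 2 * (2 * G $ 1) + W $ 3) = 2 * W $ 3"
      using T[of 3] by (simp add: W0 H H(2)[simplified] sums)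
    show "2 * (2 * G $ 4 + 2 * G $ 1 * G $ 3 + (G $ 2)\<^sup>2) + (1 - p) * (W $ 1 * (2 * G $ 3 + 2 * G $ 1 * G $ 2)
        + W $ 2 * (2 * G $ 2 + (G $ 1)\<^sup>2) + W $ 3 * (2 * G $ 1) + W $ 4) = 2 * W $ 4"
      using T[of 4] by (simp add: W0 H H(2)[simplified] sums)
  qed
qed

section \<open>Hankel determinants and reciprocal series\<close>

text \<open>For u(z) = z / f(z) the functional equation reads u(qz) - q u(z) = (1 - q) g(z) u(qz),
  that is, -q [n]_q h_n is the sum of q^(n-i) g_i h_(n-i) over i = 1, ..., n. With
  \<open>l = (1 + q) / 4\<close>, the leading factor of every g_i, \<open>v2\<close>,
  \<open>v3\<close>, \<open>v4\<close> are normalised so that l v_n = -q [n]_q h_n. Then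
  \<open>\<rho>\<close> is [3]_q^2 / ([2]_q [4]_q), and \<open>k\<close> is the factor that
  expresses the term in \<open>h3\<close> through \<open>v3\<close>.\<close>

lemma hankel_reduction:
  fixes q k \<rho> g1 g2 g3 g4 c1 c2 c3 c4 :: complex and a :: "nat \<Rightarrow> complex"
  defines "t \<equiv> 1 + q + q\<^sup>2"
  defines "v2 \<equiv> c2 - (7 - q) / 8 * c1\<^sup>2"
  defines "v3 \<equiv> c3 + (q - 6) / 4 * c1 * c2 + (18 - 5 * q + q\<^sup>2) / 32 * c1 ^ 3"
  defines "v4 \<equiv> c4 + (q - 5) / 8 * c2\<^sup>2 + ((q - 3) / 2 - k) * c1 * c3
    + ((49 - 26 * q + 5 * q\<^sup>2) / 32 + k * (6 - q) / 4) * c1\<^sup>2 * c2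
    + ((- 193 + 135 * q - 47 * q\<^sup>2 + 9 * q ^ 3) / 512 - k * (18 - 5 * q + q\<^sup>2) / 32) * c1 ^ 4"
  assumes q1: "1 + q \<noteq> 0" and t0: "t \<noteq> 0"
    and a: "(1 + q) * a 2 = a 2 + g1"
      "t * a 3 = a 3 + g1 * a 2 + g2"
      "(1 + q) * (1 + q\<^sup>2) * a 4 = a 4 + g1 * a 3 + g2 * a 2 + g3"
      "(1 + q + q\<^sup>2 + q ^ 3 + q ^ 4) * a 5 = a 5 + g1 * a 4 + g2 * a 3 + g3 * a 2 + g4"
    and g: "2 * (2 * g1) + (1 - q) * c1 = 2 * c1"
      "2 * (2 * g2 + g1\<^sup>2) + (1 - q) * (c1 * (2 * g1) + c2) = 2 * c2"
      "2 * (2 * g3 + 2 * g1 * g2) + (1 - q) * (c1 * (2 * g2 + g1\<^sup>2) + c2 * (2 * g1) + c3) = 2 * c3"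
      "2 * (2 * g4 + 2 * g1 * g3 + g2\<^sup>2)
        + (1 - q) * (c1 * (2 * g3 + 2 * g1 * g2) + c2 * (2 * g2 + g1\<^sup>2) + c3 * (2 * g1) + c4) = 2 * c4"
    and k: "4 * t * k = q\<^sup>2 * (1 + q)"
    and \<rho>: "\<rho> * ((1 + q)\<^sup>2 * (1 + q\<^sup>2)) = t\<^sup>2"
  shows "16 * q\<^sup>2 * t\<^sup>2 * hankel_3_1 a = (1 + q)\<^sup>2 * (\<rho> * v2 * v4 - v3\<^sup>2)"
proof -
  \<comment> \<open>\<open>h\<^sub>n\<close> are the coefficients of \<open>z / f z\<close>; the \<open>3 \<times> 3\<close> Hankel determinant of a power series
    with constant term 1 equals the shifted \<open>2 \<times> 2\<close> one of its reciprocal.\<close>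
  define h2 where "h2 = (a 2)\<^sup>2 - a 3"
  define h3 where "h3 = a 2 * a 3 - h2 * a 2 - a 4"
  define h4 where "h4 = a 2 * a 4 - h2 * a 3 - h3 * a 2 - a 5"
  define l where "l = (1 + q) / 4"
  have G1: "g1 = l * c1"
    using g(1) by (simp add: l_def) algebra
  have G2: "g2 = l * (c2 - (5 - 3 * q) / 8 * c1\<^sup>2)"
    using g(2) unfolding G1 l_def by (simp add: field_simps) algebra
  have G3: "g3 = l * (c3 - (5 - 3 * q) / 4 * c1 * c2 + (13 - 14 * q + 5 * q\<^sup>2) / 32 * c1 ^ 3)"
    using g(3) unfolding G1 G2 l_def by (simp add: field_simps) algebra
  have G4: "g4 = l * (c4 - (5 - 3 * q) / 8 * (c2\<^sup>2 + 2 * c1 * c3)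
      + 3 * (13 - 14 * q + 5 * q\<^sup>2) / 32 * c1\<^sup>2 * c2
      + (- 141 + 201 * q - 135 * q\<^sup>2 + 35 * q ^ 3) / 512 * c1 ^ 4)"
    using g(4) unfolding G1 G2 G3 l_def by (simp add: field_simps) algebra
  have "l * v2 = g2 - g1\<^sup>2"
    unfolding G1 G2 v2_def l_def by (simp add: field_simps) algebra
  also have "\<dots> = - (q * (1 + q) * h2)"
    using a(1,2) unfolding h2_def t_def by algebra
  finally have V2: "l * v2 = - (q * (1 + q) * h2)" .
  have "(1 + q) * (v2 / 4) = (1 + q) * (- q * h2)"
    using V2 by (simp add: l_def algebra_simps)
  then have V2': "v2 / 4 = - q * h2"
    using mult_left_cancel[OF q1] by blast
  \<comment> \<open>The recursion for \<open>h3\<close> read backwards: its term in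
    \<open>h2\<close> has been replaced by \<open>v2 / 4\<close>, so that \<open>v3\<close> is a
    polynomial in the c_i.\<close>
  have "l * v3 = g3 - g1 * g2 - q * g1 * (v2 / 4)"
    unfolding G1 G2 G3 v2_def v3_def l_def by (simp add: field_simps) algebra
  also have "\<dots> = g3 - g1 * g2 + q\<^sup>2 * g1 * h2"
    unfolding V2' by (simp add: power2_eq_square)
  also have "\<dots> = - (q * t * h3)"
    using a(1,2,3) unfolding h2_def h3_def t_def by algebra
  finally have V3: "l * v3 = - (q * t * h3)" .
  have tk: "t * k = q\<^sup>2 * l"
    using k by (simp add: l_def field_simps)
  \<comment> \<open>This rewrites the \<open>h3\<close> term of the recursion for \<open>h4\<close>;
    \<open>k\<close> absorbs the quotient of q^3 by the factor q t that links \<open>h3\<close> to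
    \<open>v3\<close>.\<close>
  have "t * (k * (l * c1 * v3)) = (t * k) * c1 * (l * v3)"
    by (simp add: mult_ac)
  also have "\<dots> = t * (- (q ^ 3 * g1 * h3))"
    unfolding tk V3 G1 by algebra
  finally have "t * (k * (l * c1 * v3)) = t * (- (q ^ 3 * g1 * h3))" .
  then have K: "k * (l * c1 * v3) = - (q ^ 3 * g1 * h3)"
    using mult_left_cancel[OF t0] by blast
  have "l * v4 = g4 - g1 * g3 - q * g2 * (v2 / 4) - k * (l * c1 * v3)"
    unfolding G1 G2 G3 G4 v2_def v3_def v4_def l_def by (simp add: field_simps) algebra
  also have "\<dots> = g4 - g1 * g3 + q\<^sup>2 * g2 * h2 + q ^ 3 * g1 * h3"
    unfolding K V2' by (simp add: power2_eq_square)
  also have "\<dots> = - (q * (1 + q) * (1 + q\<^sup>2) * h4)"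
    using a unfolding h2_def h3_def h4_def t_def by algebra
  finally have V4: "l * v4 = - (q * (1 + q) * (1 + q\<^sup>2) * h4)" .
  have H: "hankel_3_1 a = h2 * h4 - h3\<^sup>2"
    unfolding hankel_3_1_def h2_def h3_def h4_def by algebra
  have "(1 + q)\<^sup>2 * (\<rho> * v2 * v4 - v3\<^sup>2) = 16 * (\<rho> * (l * v2) * (l * v4) - (l * v3)\<^sup>2)"
    by (simp add: l_def field_simps power2_eq_square)
  also have "\<dots> = 16 * q\<^sup>2 * ((\<rho> * ((1 + q)\<^sup>2 * (1 + q\<^sup>2))) * h2 * h4 - t\<^sup>2 * h3\<^sup>2)"
    unfolding V2 V3 V4 by algebra
  also have "\<dots> = 16 * q\<^sup>2 * t\<^sup>2 * hankel_3_1 a"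
    unfolding \<rho> H by algebra
  finally show ?thesis by simp
qed

section \<open>Bounding the functional\<close>

text \<open>
  With \<open>C = |c|\<^sup>2\<close> and \<open>r = |x|\<close>, \<open>maj1\<close> bounds the coefficient of \<open>y\<close> in the functional
  below, \<open>maj2\<close> that of \<open>y\<^sup>2\<close>, \<open>maj3\<close> that of \<open>(1 - |y|\<^sup>2) w\<close> and \<open>maj0\<close> the part free of
  \<open>y\<close> and \<open>w\<close>. In \<open>maj1\<close> the factors \<open>|c|\<close> have been removed by
  \<open>|c| r \<le> 2/3 C + 3/8 r\<^sup>2\<close> and \<open>|c| \<le> 1/3 + 3/4 C\<close>, so that everything is polynomial in
  \<open>C\<close> and \<open>r\<close>. The two inequalities that follow are certified by nonnegative coefficients in
  the Bernstein basis.
\<close>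

definition maj0 :: "real \<Rightarrow> real \<Rightarrow> real" where
  "maj0 C r = C ^ 3 / 4 + 7 / 8 * (1 - C) * C\<^sup>2 * r
     + (1 - C) * C * (4 / 5 * (1 - C) + 5 / 8 * C) * r\<^sup>2
     + (1 - C) * (45 / 64 * (1 - C)\<^sup>2 + 3 / 2 * C * (1 - C) + C\<^sup>2) * r ^ 3
     + (1 - C)\<^sup>2 * C / 8 * r ^ 4"

definition maj1 :: "real \<Rightarrow> real \<Rightarrow> real" where
  "maj1 C r = (2 / 3 * C + 3 / 8 * r\<^sup>2) * ((1 - C) * r / 4 + 3 / 2 * (1 - C) + 2 * C)
     + 5 / 8 * C * (1 / 3 + 3 / 4 * C)"

definition maj2 :: "real \<Rightarrow> real \<Rightarrow> real" where
  "maj2 C r = (1 - C) + (1 - C) * r\<^sup>2 / 8 + C * r"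

definition maj3 :: "real \<Rightarrow> real \<Rightarrow> real" where
  "maj3 C r = 9 / 8 * (1 - C) * r + C"

lemma majorant_y1:
  assumes "0 \<le> C" "C \<le> 1" "0 \<le> r" "r \<le> 1"
  shows "maj0 C r + (1 - C) * (1 - r\<^sup>2) * (maj1 C r + maj2 C r) \<le> 1"
proof -
  define s u where "s = 1 - C" and "u = 1 - r"
  have nn: "0 \<le> s" "0 \<le> u" using assms by (auto simp: s_def u_def)
  \<comment> \<open>The number 960 is the common denominator of the coefficients of the majorants.
    The right side is homogeneous of degree 3 in \<open>C, s\<close> and of degree 6 in
    \<open>r, u\<close>, using C + s = 1 and r + u = 1.\<close>
  have "960 * (1 - (maj0 C r + (1 - C) * (1 - r\<^sup>2) * (maj1 C r + maj2 C r))) =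
      (760 * C * s ^ 2 + 950 * C ^ 2 * s + 720 * C ^ 3) * u ^ 6
      + (3440 * C * s ^ 2 + 3900 * C ^ 2 * s + 4320 * C ^ 3) * r * u ^ 5
      + (300 * s ^ 3 + 5772 * C * s ^ 2 + 5860 * C ^ 2 * s + 10800 * C ^ 3) * r ^ 2 * u ^ 4
      + (435 * s ^ 3 + 3478 * C * s ^ 2 + 3440 * C ^ 2 * s + 14400 * C ^ 3) * r ^ 3 * u ^ 3
      + (165 * s ^ 3 + 62 * C * s ^ 2 + 630 * C ^ 2 * s + 10800 * C ^ 3) * r ^ 4 * u ^ 2
      + (315 * s ^ 3 + 228 * C * s ^ 2 + 580 * C ^ 2 * s + 4320 * C ^ 3) * r ^ 5 * u
      + (285 * s ^ 3 + 552 * C * s ^ 2 + 480 * C ^ 2 * s + 720 * C ^ 3) * r ^ 6"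
    unfolding maj0_def maj1_def maj2_def s_def u_def by (simp add: divide_simps) algebra
  also have "\<dots> \<ge> 0" using nn assms by (intro add_nonneg_nonneg mult_nonneg_nonneg zero_le_power) auto
  finally show ?thesis by (simp add: zero_le_mult_iff)
qed

lemma majorant_y0:
  assumes "0 \<le> C" "C \<le> 1" "0 \<le> r" "r \<le> 1"
  shows "maj0 C r + (1 - C) * (1 - r\<^sup>2) * (maj1 C r + maj3 C r) \<le> 1"
proof -
  define s u where "s = 1 - C" and "u = 1 - r"
  have nn: "0 \<le> s" "0 \<le> u" using assms by (auto simp: s_def u_def)
  \<comment> \<open>In degree 3, and still in degree 4, in \<open>C, s\<close> the row of r^4 u^2
    has negative coefficients; raising the degree to 5 with (C + s)^2 = 1 removes them.\<close>
  have "960 * (1 - (maj0 C r + (1 - C) * (1 - r\<^sup>2) * (maj1 C r + maj3 C r))) =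
      (960 * s ^ 5 + 2680 * C * s ^ 4 + 2470 * C ^ 2 * s ^ 3 + 1460 * C ^ 3 * s ^ 2 + 1430 * C ^ 4 * s + 720 * C ^ 5) * u ^ 6
      + (4680 * s ^ 5 + 12680 * C * s ^ 4 + 10420 * C ^ 2 * s ^ 3 + 5840 * C ^ 3 * s ^ 2 + 7740 * C ^ 4 * s + 4320 * C ^ 5) * r * u ^ 5
      + (8460 * s ^ 5 + 22212 * C * s ^ 4 + 16264 * C ^ 2 * s ^ 3 + 10532 * C ^ 3 * s ^ 2 + 18820 * C ^ 4 * s + 10800 * C ^ 5) * r ^ 2 * u ^ 4
      + (6555 * s ^ 5 + 15988 * C * s ^ 4 + 9031 * C ^ 2 * s ^ 3 + 10718 * C ^ 3 * s ^ 2 + 25520 * C ^ 4 * s + 14400 * C ^ 5) * r ^ 3 * u ^ 3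
      + (1845 * s ^ 5 + 3512 * C * s ^ 4 + 199 * C ^ 2 * s ^ 3 + 8042 * C ^ 3 * s ^ 2 + 20310 * C ^ 4 * s + 10800 * C ^ 5) * r ^ 4 * u ^ 2
      + (315 * s ^ 5 + 858 * C * s ^ 4 + 1351 * C ^ 2 * s ^ 3 + 5708 * C ^ 3 * s ^ 2 + 9220 * C ^ 4 * s + 4320 * C ^ 5) * r ^ 5 * u
      + (285 * s ^ 5 + 1122 * C * s ^ 4 + 1869 * C ^ 2 * s ^ 3 + 2232 * C ^ 3 * s ^ 2 + 1920 * C ^ 4 * s + 720 * C ^ 5) * r ^ 6"
    unfolding maj0_def maj1_def maj3_def s_def u_def by (simp add: divide_simps) algebra
  also have "\<dots> \<ge> 0" using nn assms by (intro add_nonneg_nonneg mult_nonneg_nonneg zero_le_power) auto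
  finally show ?thesis by (simp add: zero_le_mult_iff)
qed

text \<open>The parameter q enters only through numerical bounds on the eight real constants, so it
  disappears from the extremal problem. After the expansion in \<open>y\<close> and
  \<open>w\<close>, every term with a \<open>y\<close> or \<open>w\<close> carries the factor (1 -
  |c|^2)(1 - |x|^2), which leaves room for crude estimates.\<close>

lemma functional_bound:
  fixes c x y w c2 c3 c4 :: complex and \<rho> \<beta> \<alpha> \<gamma> d1 d2 d3 d4 :: real
  assumes norms: "norm c \<le> 1" "norm x \<le> 1" "norm y \<le> 1" "norm w \<le> 1"
    and c2: "c2 = (1 - c * cnj c) * x"
    and c3: "c3 = (1 - c * cnj c) * ((1 - x * cnj x) * y - cnj c * x\<^sup>2)"
    and c4: "c4 = (1 - c * cnj c) *
       ((1 - x * cnj x) * ((1 - y * cnj y) * w - cnj x * y\<^sup>2)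
        - 2 * cnj c * (1 - x * cnj x) * x * y + (cnj c)\<^sup>2 * x ^ 3)"
    and \<rho>: "1 \<le> \<rho>" "\<rho> \<le> 9 / 8"
    and \<rho>\<beta>: "0 \<le> \<rho> * \<beta>" "\<rho> * \<beta> \<le> 1"
    and k0: "\<bar>\<rho> * \<beta> * d2 + 2 * \<gamma>\<bar> \<le> 5 / 8"
    and k1: "0 \<le> \<rho> * d2 - 2 * \<alpha>" "\<rho> * d2 - 2 * \<alpha> \<le> 3 / 2"
    and e0: "\<bar>\<rho> * \<beta> * d4 + \<gamma>\<^sup>2\<bar> \<le> 1 / 4"
    and e1: "\<bar>\<rho> * d4 - \<rho> * \<beta> * d3 - 2 * \<alpha> * \<gamma>\<bar> \<le> 7 / 8"
    and e2: "\<bar>\<rho> * d3 - \<rho> * \<beta> * d1 - \<alpha>\<^sup>2\<bar> \<le> 4 / 5"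
    and d1: "\<bar>\<rho> * d1\<bar> \<le> 45 / 64"
  shows "norm (of_real \<rho> * (c2 - of_real \<beta> * c\<^sup>2)
       * (c4 + of_real d1 * c2\<^sup>2 + of_real d2 * c * c3 + of_real d3 * c\<^sup>2 * c2 + of_real d4 * c ^ 4)
     - (c3 + of_real \<alpha> * c * c2 + of_real \<gamma> * c ^ 3)\<^sup>2) \<le> 1" (is "norm ?F \<le> 1")
proof -
  define C r Y where "C = (cmod c)\<^sup>2" and "r = cmod x" and "Y = (cmod y)\<^sup>2"
  define s t where "s = 1 - C" and "t = 1 - r\<^sup>2"
  have C: "0 \<le> C" "C \<le> 1" and r: "0 \<le> r" "r \<le> 1" and Y: "0 \<le> Y" "Y \<le> 1"
    using norms by (auto simp: C_def r_def Y_def power_le_one)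
  have s: "0 \<le> s" "s \<le> 1" and t: "0 \<le> t"
    using C r by (auto simp: s_def t_def power_le_one)
  have CC: "of_real C = c * cnj c" and RR: "(of_real r)\<^sup>2 = x * cnj x" and YY: "of_real Y = y * cnj y"
    by (simp_all only: C_def r_def Y_def complex_norm_square flip: of_real_power)
  have pow: "cmod c ^ 2 = C" "cmod c ^ 4 = C\<^sup>2" "cmod c ^ 6 = C ^ 3"
    by (simp_all add: C_def flip: power_mult)
  define k2 k where "k2 = \<rho> * \<beta> * d2 + 2 * \<gamma>" and "k = \<rho> * d2 - 2 * \<alpha>"
  define l0 l1 l2 where "l0 = \<rho> * \<beta> * d4 + \<gamma>\<^sup>2" and "l1 = \<rho> * d4 - \<rho> * \<beta> * d3 - 2 * \<alpha> * \<gamma>"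
    and "l2 = \<rho> * d3 - \<rho> * \<beta> * d1 - \<alpha>\<^sup>2"
  define K3 where "K3 = \<rho> * d1 * s\<^sup>2 - k * C * s - \<rho> * \<beta> * C\<^sup>2"
  define K2 where "K2 = l2 * s + k2 * C"
  \<comment> \<open>Expand in powers of \<open>y\<close> and \<open>w\<close> first: bounding the three coefficients of the functional
    separately would lose the cancellation between \<open>\<rho> * d2\<close> and \<open>2 * \<alpha>\<close> in \<open>L\<close>.\<close>
  define A where "A = of_real ((\<rho> - 1) * s\<^sup>2) * (cnj c)\<^sup>2 * x ^ 4 + of_real (s * K3) * x ^ 3
     + of_real (s * K2) * c\<^sup>2 * x\<^sup>2 + of_real (s * l1) * c ^ 4 * x - of_real l0 * c ^ 6"
  define L where "L = of_real (k * s + 2 * \<rho> * \<beta> * C) * c * x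
     - of_real (2 * (\<rho> - 1) * s) * cnj c * x\<^sup>2 - of_real k2 * c ^ 3"
  define Q where "Q = of_real (s + (\<rho> - 1) * s * r\<^sup>2) - of_real (\<rho> * \<beta>) * c\<^sup>2 * cnj x"
  define R where "R = of_real (\<rho> * s) * x - of_real (\<rho> * \<beta>) * c\<^sup>2"
  have F: "?F = A + of_real (s * t) * (L * y - Q * y\<^sup>2 + of_real (1 - Y) * R * w)"
    unfolding A_def L_def Q_def R_def K2_def K3_def k2_def k_def l0_def l1_def l2_def s_def t_def c2 c3 c4
    by (simp only: of_real_add of_real_diff of_real_mult of_real_power of_real_1 of_real_numeral CC RR YY)
       algebra
  have nA: "norm A \<le> maj0 C r"
  proof -
    have 1: "norm (of_real ((\<rho> - 1) * s\<^sup>2) * (cnj c)\<^sup>2 * x ^ 4) \<le> s\<^sup>2 * C / 8 * r ^ 4"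
    proof -
      have "(\<rho> - 1) * (s\<^sup>2 * C * r ^ 4) \<le> 1 / 8 * (s\<^sup>2 * C * r ^ 4)"
        using \<rho> C r s by (intro mult_right_mono) auto
      then show ?thesis using \<rho> s unfolding norm_mult norm_of_real norm_power complex_mod_cnj pow r_def[symmetric] 
        by (simp add: abs_mult mult.assoc)
    qed
    have 2: "norm (of_real (s * K3) * x ^ 3) \<le> s * (45 / 64 * s\<^sup>2 + 3 / 2 * C * s + C\<^sup>2) * r ^ 3"
    proof -
      have "\<bar>\<rho> * d1 * s\<^sup>2\<bar> \<le> 45 / 64 * s\<^sup>2"
        using mult_right_mono[OF d1, of "s\<^sup>2"] by (simp add: abs_mult)
      moreover have "0 \<le> k * (C * s)" "k * (C * s) \<le> 3 / 2 * (C * s)"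
        using mult_right_mono[OF k1(2), of "C * s"] k1(1) C s by (simp_all add: k_def)
      moreover have "0 \<le> \<rho> * \<beta> * C\<^sup>2" "\<rho> * \<beta> * C\<^sup>2 \<le> 1 * C\<^sup>2"
        using mult_right_mono[OF \<rho>\<beta>(2), of "C\<^sup>2"] \<rho>\<beta>(1) by simp_all
      ultimately have "\<bar>K3\<bar> \<le> 45 / 64 * s\<^sup>2 + 3 / 2 * C * s + C\<^sup>2"
        unfolding K3_def abs_le_iff by (simp only: mult.assoc) linarith
      then have "s * \<bar>K3\<bar> * r ^ 3 \<le> s * (45 / 64 * s\<^sup>2 + 3 / 2 * C * s + C\<^sup>2) * r ^ 3"
        using s r by (intro mult_right_mono mult_left_mono) auto
      then show ?thesis using s by (simp add: norm_mult norm_power abs_mult r_def)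
    qed
    have 3: "norm (of_real (s * K2) * c\<^sup>2 * x\<^sup>2) \<le> s * C * (4 / 5 * s + 5 / 8 * C) * r\<^sup>2"
    proof -
      have "\<bar>l2 * s\<bar> \<le> 4 / 5 * s" "\<bar>k2 * C\<bar> \<le> 5 / 8 * C"
        using mult_right_mono[OF e2, of s] mult_right_mono[OF k0, of C] s C
        by (simp_all add: l2_def k2_def abs_mult)
      then have "\<bar>K2\<bar> \<le> 4 / 5 * s + 5 / 8 * C" unfolding K2_def by linarith
      then have "s * C * \<bar>K2\<bar> * r\<^sup>2 \<le> s * C * (4 / 5 * s + 5 / 8 * C) * r\<^sup>2"
        using s r C by (intro mult_right_mono mult_left_mono) auto
      then show ?thesis using s by (simp add: norm_mult norm_power abs_mult r_def pow mult_ac)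
    qed
    have 4: "norm (of_real (s * l1) * c ^ 4 * x) \<le> 7 / 8 * s * C\<^sup>2 * r"
    proof -
      have "\<bar>l1\<bar> * (s * C\<^sup>2 * r) \<le> 7 / 8 * (s * C\<^sup>2 * r)"
        using e1 s r C by (intro mult_right_mono) (auto simp: l1_def)
      then show ?thesis using s by (simp add: norm_mult norm_power abs_mult r_def pow mult_ac)
    qed
    have 5: "norm (of_real l0 * c ^ 6) \<le> C ^ 3 / 4"
    proof -
      have "\<bar>l0\<bar> * C ^ 3 \<le> 1 / 4 * C ^ 3"
        using e0 C by (intro mult_right_mono) (auto simp: l0_def)
      then show ?thesis by (simp add: norm_mult norm_power pow)
    qed
    have "norm A \<le> s\<^sup>2 * C / 8 * r ^ 4 + s * (45 / 64 * s\<^sup>2 + 3 / 2 * C * s + C\<^sup>2) * r ^ 3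
       + s * C * (4 / 5 * s + 5 / 8 * C) * r\<^sup>2 + 7 / 8 * s * C\<^sup>2 * r + C ^ 3 / 4"
      unfolding A_def by (intro norm_triangle_mono norm_triangle_le_diff add_mono 1 2 3 4 5)
    then show ?thesis by (simp add: maj0_def s_def)
  qed
  have nL: "norm L \<le> maj1 C r"
  proof -
    \<comment> \<open>This and the next estimate are weighted AM-GM inequalities, with equality at
      |c| = 3r/4 and at |c| = 2/3.\<close>
    have cr: "cmod c * r \<le> 2 / 3 * C + 3 / 8 * r\<^sup>2"
    proof -
      have "0 \<le> (4 * cmod c - 3 * r)\<^sup>2" by simp
      then show ?thesis by (simp add: C_def power2_eq_square algebra_simps)
    qed
    have c: "cmod c \<le> 1 / 3 + 3 / 4 * C"
    proof -
      have "0 \<le> (3 * cmod c - 2)\<^sup>2" by simp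
      then show ?thesis by (simp add: C_def power2_eq_square algebra_simps)
    qed
    have 1: "norm (of_real (k * s + 2 * \<rho> * \<beta> * C) * c * x) \<le> (3 / 2 * s + 2 * C) * (cmod c * r)"
    proof -
      have "0 \<le> k * s" "k * s \<le> 3 / 2 * s" "0 \<le> \<rho> * \<beta> * C" "\<rho> * \<beta> * C \<le> 1 * C"
        using mult_right_mono[OF k1(2), of s] mult_right_mono[OF \<rho>\<beta>(2), of C] k1(1) \<rho>\<beta>(1) s C
        by (simp_all add: k_def)
      then have "\<bar>k * s + 2 * \<rho> * \<beta> * C\<bar> \<le> 3 / 2 * s + 2 * C" by (simp add: mult.assoc)
      then have "\<bar>k * s + 2 * \<rho> * \<beta> * C\<bar> * (cmod c * r) \<le> (3 / 2 * s + 2 * C) * (cmod c * r)"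
        using r by (intro mult_right_mono) auto
      then show ?thesis by (simp only: norm_mult norm_of_real r_def mult.assoc)
    qed
    have 2: "norm (of_real (2 * (\<rho> - 1) * s) * cnj c * x\<^sup>2) \<le> s * r / 4 * (cmod c * r)"
    proof -
      have "(2 * (\<rho> - 1)) * (s * cmod c * r\<^sup>2) \<le> (1 / 4) * (s * cmod c * r\<^sup>2)"
        using \<rho> s by (intro mult_right_mono) auto
      then show ?thesis using \<rho> s unfolding norm_mult norm_of_real norm_power complex_mod_cnj pow r_def[symmetric] 
        by (simp add: abs_mult power2_eq_square mult_ac)
    qed
    have 3: "norm (of_real k2 * c ^ 3) \<le> 5 / 8 * C * cmod c"
    proof -
      have "\<bar>k2\<bar> * (C * cmod c) \<le> 5 / 8 * (C * cmod c)"
        using k0 C by (intro mult_right_mono) (auto simp: k2_def)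
      then show ?thesis by (simp add: norm_mult norm_power C_def power2_eq_square power3_eq_cube mult_ac)
    qed
    have "norm L \<le> (3 / 2 * s + 2 * C) * (cmod c * r) + s * r / 4 * (cmod c * r) + 5 / 8 * C * cmod c"
      unfolding L_def using 1 2 3 by (smt norm_triangle_ineq4)
    also have "\<dots> = (cmod c * r) * (s * r / 4 + 3 / 2 * s + 2 * C) + 5 / 8 * C * cmod c"
      by (simp add: algebra_simps)
    also have "\<dots> \<le> maj1 C r"
      unfolding maj1_def s_def[symmetric] using s r C
      by (intro add_mono mult_right_mono mult_left_mono cr c) auto
    finally show ?thesis .
  qed
  have nQ: "norm Q \<le> maj2 C r"
  proof -
    have "(\<rho> - 1) * (s * r\<^sup>2) \<le> 1 / 8 * (s * r\<^sup>2)" "0 \<le> (\<rho> - 1) * (s * r\<^sup>2)"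
      using mult_right_mono[of "\<rho> - 1" "1 / 8" "s * r\<^sup>2"] \<rho> s by simp_all
    then have "norm (of_real (s + (\<rho> - 1) * s * r\<^sup>2) :: complex) \<le> s + s * r\<^sup>2 / 8"
      using s unfolding norm_of_real by (simp add: mult.assoc)
    moreover have "(\<rho> * \<beta>) * (C * r) \<le> 1 * (C * r)"
      using \<rho>\<beta> C r by (intro mult_right_mono) auto
    then have "norm (of_real (\<rho> * \<beta>) * c\<^sup>2 * cnj x) \<le> C * r"
      using \<rho>\<beta> unfolding norm_mult norm_of_real norm_power pow complex_mod_cnj r_def[symmetric]
      by (simp add: mult.assoc)
    ultimately show ?thesis
      unfolding Q_def maj2_def s_def[symmetric] by (smt norm_triangle_ineq4)
  qed
  have nR: "norm R \<le> maj3 C r"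
  proof -
    have "\<rho> * (s * r) \<le> 9 / 8 * (s * r)"
      using \<rho> s r by (intro mult_right_mono) auto
    then have "norm (of_real (\<rho> * s) * x) \<le> 9 / 8 * s * r"
      using \<rho> s by (simp add: norm_mult abs_mult r_def mult.assoc)
    moreover have "(\<rho> * \<beta>) * C \<le> 1 * C"
      using \<rho>\<beta> C by (intro mult_right_mono) auto
    then have "norm (of_real (\<rho> * \<beta>) * c\<^sup>2) \<le> C"
      using \<rho>\<beta> unfolding norm_mult norm_of_real norm_power pow by simp
    ultimately show ?thesis
      unfolding R_def maj3_def s_def[symmetric] by (smt norm_triangle_ineq4)
  qed
  note maj_nonneg = order_trans[OF norm_ge_zero nL] order_trans[OF norm_ge_zero nR]
  \<comment> \<open>In the linear term |y| is bounded by 1. The total bound is then affine in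
    \<open>Y\<close>, so only its endpoints \<open>Y = 1\<close> and \<open>Y = 0\<close> matter,
    and these are \<open>majorant_y1\<close> and \<open>majorant_y0\<close>.\<close>
  have "norm (L * y) \<le> maj1 C r * 1"
    unfolding norm_mult using nL norms(3) maj_nonneg by (intro mult_mono) auto
  moreover have "norm (Q * y\<^sup>2) \<le> maj2 C r * Y"
    unfolding norm_mult norm_power Y_def[symmetric] using nQ Y by (intro mult_right_mono) auto
  moreover have "norm (of_real (1 - Y) * R * w) \<le> (1 - Y) * maj3 C r * 1"
    unfolding norm_mult norm_of_real using nR Y norms(4) maj_nonneg
    by (intro mult_mono mult_nonneg_nonneg) auto
  ultimately have "norm (L * y - Q * y\<^sup>2 + of_real (1 - Y) * R * w)
      \<le> maj1 C r + maj2 C r * Y + (1 - Y) * maj3 C r"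
    by (smt norm_triangle_ineq norm_triangle_ineq4)
  then have "norm ?F \<le> maj0 C r + s * t * (maj1 C r + maj2 C r * Y + (1 - Y) * maj3 C r)"
    unfolding F using nA s t
    by (intro norm_triangle_mono) (simp_all add: norm_mult mult_left_mono)
  also have "\<dots> = Y * (maj0 C r + (1 - C) * (1 - r\<^sup>2) * (maj1 C r + maj2 C r))
      + (1 - Y) * (maj0 C r + (1 - C) * (1 - r\<^sup>2) * (maj1 C r + maj3 C r))"
    by (simp add: s_def t_def algebra_simps)
  also have "\<dots> \<le> Y * 1 + (1 - Y) * 1"
    using Y by (intro add_mono mult_left_mono majorant_y1 majorant_y0 C r) auto
  finally show ?thesis by simp
qed

section \<open>Enclosures of the constants depending on q\<close>

lemma mult_range:
  fixes x y :: real
  assumes "0 \<le> l" "l \<le> x" "x \<le> u" "0 \<le> m" "m \<le> y" "y \<le> v"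
  shows "l * m \<le> x * y" "x * y \<le> u * v"
  using assms by (auto intro!: mult_mono)

text \<open>Interval arithmetic: each constant is enclosed between two numbers valid for all q in
  (0,1), and products are bounded by products of endpoints. Only the upper bound of
  \<open>\<rho> * d2 - 2 * \<alpha>\<close> needs the correlation between the constants.\<close>

lemma sl_constant_bounds:
  fixes q :: real
  assumes q: "0 < q" "q < 1"
  defines "t \<equiv> 1 + q + q\<^sup>2"
  defines "\<rho> \<equiv> t\<^sup>2 / ((1 + q)\<^sup>2 * (1 + q\<^sup>2))" and "k \<equiv> q\<^sup>2 * (1 + q) / (4 * t)"
  defines "\<beta> \<equiv> (7 - q) / 8" and "\<alpha> \<equiv> (q - 6) / 4" and "\<gamma> \<equiv> (18 - 5 * q + q\<^sup>2) / 32"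
    and "d1 \<equiv> (q - 5) / 8" and "d2 \<equiv> (q - 3) / 2 - k"
    and "d3 \<equiv> (49 - 26 * q + 5 * q\<^sup>2) / 32 + k * (6 - q) / 4"
    and "d4 \<equiv> (- 193 + 135 * q - 47 * q\<^sup>2 + 9 * q ^ 3) / 512 - k * (18 - 5 * q + q\<^sup>2) / 32"
  shows "1 \<le> \<rho>" "\<rho> \<le> 9 / 8" "0 \<le> \<rho> * \<beta>" "\<rho> * \<beta> \<le> 1"
    and "\<bar>\<rho> * \<beta> * d2 + 2 * \<gamma>\<bar> \<le> 5 / 8"
    and "0 \<le> \<rho> * d2 - 2 * \<alpha>" "\<rho> * d2 - 2 * \<alpha> \<le> 3 / 2"
    and "\<bar>\<rho> * \<beta> * d4 + \<gamma>\<^sup>2\<bar> \<le> 1 / 4"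
    and "\<bar>\<rho> * d4 - \<rho> * \<beta> * d3 - 2 * \<alpha> * \<gamma>\<bar> \<le> 7 / 8"
    and "\<bar>\<rho> * d3 - \<rho> * \<beta> * d1 - \<alpha>\<^sup>2\<bar> \<le> 4 / 5"
    and "\<bar>\<rho> * d1\<bar> \<le> 45 / 64"
proof -
  \<comment> \<open>Most enclosures below are linear in q, q^2, q^3 and \<open>k\<close>, given
    these relations and the bounds q^2/6 \<le> k \<le> q^2/4.\<close>
  have sq: "0 \<le> q\<^sup>2" "q\<^sup>2 \<le> q" "q ^ 3 \<le> q\<^sup>2" "0 \<le> q ^ 3"
    using q power_decreasing[of 1 2 q] power_decreasing[of 2 3 q] by simp_all
  have t: "t > 0" using q by (simp add: t_def add_pos_nonneg)
  have den: "0 < (1 + q)\<^sup>2 * (1 + q\<^sup>2)"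
    using q by (intro mult_pos_pos) (auto intro: add_pos_nonneg)
  have "t\<^sup>2 = (1 + q)\<^sup>2 * (1 + q\<^sup>2) + q\<^sup>2"
    unfolding t_def by algebra
  then have \<rho>1: "1 \<le> \<rho>"
    using den by (simp add: \<rho>_def)
  have "9 * ((1 + q)\<^sup>2 * (1 + q\<^sup>2)) - 8 * t\<^sup>2 = (1 - q)\<^sup>2 * ((1 + q)\<^sup>2 + 2 * q)"
    unfolding t_def by algebra
  also have "\<dots> \<ge> 0" using q by simp
  finally have \<rho>2: "\<rho> \<le> 9 / 8"
    using den by (simp add: \<rho>_def field_simps)
  have "q\<^sup>2 * (1 + q) \<le> q\<^sup>2 * t"
    using sq by (intro mult_left_mono) (auto simp: t_def)
  then have k1: "k \<le> q\<^sup>2 / 4" using t by (simp add: k_def field_simps)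
  have "q\<^sup>2 * (2 * t) \<le> q\<^sup>2 * (3 * (1 + q))"
    using sq q by (intro mult_left_mono) (auto simp: t_def)
  then have k2: "q\<^sup>2 / 6 \<le> k" using t by (simp add: k_def field_simps)
  have k0: "0 \<le> k" using k2 sq by linarith
  have \<beta>: "3 / 4 \<le> \<beta>" "\<beta> \<le> 7 / 8" unfolding \<beta>_def using q by argo+
  have \<alpha>: "5 / 4 \<le> - \<alpha>" "- \<alpha> \<le> 3 / 2" unfolding \<alpha>_def using q by argo+
  have \<gamma>: "7 / 16 \<le> \<gamma>" "\<gamma> \<le> 9 / 16"
  proof -
    have "0 \<le> (1 - q) * (4 - q)" using q by simp
    then show "7 / 16 \<le> \<gamma>" by (simp add: \<gamma>_def power2_eq_square algebra_simps)
    show "\<gamma> \<le> 9 / 16" using q sq unfolding \<gamma>_def by argo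
  qed
  have d1: "1 / 2 \<le> - d1" "- d1 \<le> 5 / 8" unfolding d1_def using q by argo+
  have d2: "7 / 6 \<le> - d2" "- d2 \<le> 3 / 2"
  proof -
    show "- d2 \<le> 3 / 2" using k1 sq q unfolding d2_def by argo
    have "0 \<le> (1 - q) * (2 - q)" using q by simp
    then have "3 * q \<le> q\<^sup>2 + 2" by (simp add: power2_eq_square algebra_simps)
    then show "7 / 6 \<le> - d2" using k2 unfolding d2_def by argo
  qed
  have d3: "13 / 12 \<le> d3" "d3 \<le> 49 / 32"
  proof -
    define K where "K = k * (6 - q)"
    have d3_eq: "d3 = (49 - 26 * q + 5 * q\<^sup>2) / 32 + K / 4"
      by (simp add: d3_def K_def)
    have "q\<^sup>2 - q ^ 3 / 6 = q\<^sup>2 / 6 * (6 - q)"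
      by (simp add: field_simps power2_eq_square power3_eq_cube)
    also have "\<dots> \<le> K" unfolding K_def using k2 q by (intro mult_right_mono) auto
    finally have 1: "q\<^sup>2 - q ^ 3 / 6 \<le> K" .
    have "0 \<le> (1 - q) * (43 - 35 * q + 4 * q\<^sup>2)"
      using q by (intro mult_nonneg_nonneg) auto
    \<comment> \<open>This cubic is 96 times the excess over 13/12 of the lower bound for
      \<open>d3\<close> that the estimate of \<open>K\<close> provides.\<close>
    also have "\<dots> = 43 - 78 * q + 39 * q\<^sup>2 - 4 * q ^ 3" by algebra
    finally show "13 / 12 \<le> d3" using 1 unfolding d3_eq by argo
    have "K \<le> q\<^sup>2 / 4 * 6" unfolding K_def using k1 k0 q by (intro mult_mono) auto
    then show "d3 \<le> 49 / 32" using sq q unfolding d3_eq by argo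
  qed
  have d4: "1 / 4 \<le> - d4" "- d4 \<le> 39 / 100"
  proof -
    have d4_eq: "d4 = (- 193 + 135 * q - 47 * q\<^sup>2 + 9 * q ^ 3) / 512 - k * \<gamma>"
      by (simp add: d4_def \<gamma>_def)
    have 1: "q\<^sup>2 / 6 * (7 / 16) \<le> k * \<gamma>" using k2 \<gamma> k0 by (intro mult_mono) auto
    have 2: "k * \<gamma> \<le> q\<^sup>2 / 4 * (9 / 16)" using k1 k0 \<gamma> by (intro mult_mono) auto
    show "- d4 \<le> 39 / 100" using 2 sq q unfolding d4_eq by argo
    \<comment> \<open>After q^3 \<le> q^2 a quadratic in q remains whose minimum lies near 9/10, so
      the square is centred there.\<close>
    have "0 \<le> (10 * q - 9)\<^sup>2" by simp
    then have "20 * (9 * q) \<le> 100 * q\<^sup>2 + 81" by (simp add: power2_eq_square algebra_simps)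
    then show "1 / 4 \<le> - d4" using 1 sq unfolding d4_eq by argo
  qed
  have \<rho>\<beta>: "3 / 4 \<le> \<rho> * \<beta>" "\<rho> * \<beta> \<le> 63 / 64"
    using mult_range[of 1 \<rho> "9 / 8" "3 / 4" \<beta> "7 / 8"] \<rho>1 \<rho>2 \<beta> by simp_all
  show "1 \<le> \<rho>" "\<rho> \<le> 9 / 8" by fact+
  show "0 \<le> \<rho> * \<beta>" "\<rho> * \<beta> \<le> 1" using \<rho>\<beta> by linarith+
  note R = mult_range[OF _ \<rho>1 \<rho>2]
  note RB = mult_range[OF _ \<rho>\<beta>]
  show "\<bar>\<rho> * \<beta> * d2 + 2 * \<gamma>\<bar> \<le> 5 / 8"
    unfolding abs_le_iff using RB[OF _ _ d2] \<gamma> by simp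
  show "0 \<le> \<rho> * d2 - 2 * \<alpha>"
    using R(2)[OF _ _ d2] \<alpha> by simp
  \<comment> \<open>The enclosures would only give 3 - 7/6 = 11/6. Since \<open>d2\<close> is
    negative, \<rho> \<ge> 1 gives \<open>\<rho> * d2 \<le> d2\<close>, and then the q-dependence of
    \<open>d2\<close> and \<open>2 * \<alpha>\<close> cancels up to \<open>- k\<close>.\<close>
  have "1 * (- d2) \<le> \<rho> * (- d2)" using \<rho>1 d2 by (intro mult_right_mono) auto
  then have "\<rho> * d2 \<le> d2" by simp
  moreover have "d2 - 2 * \<alpha> = 3 / 2 - k" by (simp add: \<alpha>_def d2_def field_simps)
  ultimately show "\<rho> * d2 - 2 * \<alpha> \<le> 3 / 2" using k0 by linarith
  have "(7 / 16)\<^sup>2 \<le> \<gamma>\<^sup>2" "\<gamma>\<^sup>2 \<le> (9 / 16)\<^sup>2" using \<gamma> by (auto intro!: power_mono)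
  then show "\<bar>\<rho> * \<beta> * d4 + \<gamma>\<^sup>2\<bar> \<le> 1 / 4"
    unfolding abs_le_iff using RB[OF _ _ d4] by (simp add: power_divide)
  show "\<bar>\<rho> * d4 - \<rho> * \<beta> * d3 - 2 * \<alpha> * \<gamma>\<bar> \<le> 7 / 8"
    unfolding abs_le_iff using R[OF _ _ d4] RB[OF _ _ d3] mult_range[OF _ \<alpha> _ \<gamma>] by simp
  have "(5 / 4)\<^sup>2 \<le> (- \<alpha>)\<^sup>2" "(- \<alpha>)\<^sup>2 \<le> (3 / 2)\<^sup>2" using \<alpha> by (intro power_mono; simp)+
  then show "\<bar>\<rho> * d3 - \<rho> * \<beta> * d1 - \<alpha>\<^sup>2\<bar> \<le> 4 / 5"
    unfolding abs_le_iff using R[OF _ _ d3] RB[OF _ _ d1] by (simp add: power_divide)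
  show "\<bar>\<rho> * d1\<bar> \<le> 45 / 64"
    unfolding abs_le_iff using R[OF _ _ d1] by simp
qed

section \<open>Combination of the reduction with the bound\<close>

theorem theorem2p1:
  fixes q :: real and f :: "complex \<Rightarrow> complex" and a :: "nat \<Rightarrow> complex"
  assumes "0 < q" and "q < 1"
    and "f \<in> class_SL q"
    and "has_normalized_expansion f a"
  shows "norm (hankel_3_1 a) \<le> (1 + q)\<^sup>2 / (16 * q\<^sup>2 * (1 + q + q\<^sup>2)\<^sup>2)"
proof -
  note q = assms(1,2)
  define t where "t = 1 + q + q\<^sup>2"
  define \<rho> k where "\<rho> = t\<^sup>2 / ((1 + q)\<^sup>2 * (1 + q\<^sup>2))" and "k = q\<^sup>2 * (1 + q) / (4 * t)"
  define \<beta> \<alpha> \<gamma> where "\<beta> = (7 - q) / 8" and "\<alpha> = (q - 6) / 4" and "\<gamma> = (18 - 5 * q + q\<^sup>2) / 32"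
  define d1 d2 where "d1 = (q - 5) / 8" and "d2 = (q - 3) / 2 - k"
  define d3 d4 where "d3 = (49 - 26 * q + 5 * q\<^sup>2) / 32 + k * (6 - q) / 4"
    and "d4 = (- 193 + 135 * q - 47 * q\<^sup>2 + 9 * q ^ 3) / 512 - k * (18 - 5 * q + q\<^sup>2) / 32"
  note const_defs = t_def \<rho>_def k_def \<beta>_def \<alpha>_def \<gamma>_def d1_def d2_def d3_def d4_def
  define p where "p = complex_of_real q"
  have t0: "t > 0" using q by (simp add: t_def add_pos_nonneg)
  have den: "0 < (1 + q)\<^sup>2 * (1 + q\<^sup>2)"
    using q by (intro mult_pos_pos) (auto intro: add_pos_nonneg)
  have pq: "1 + p = of_real (1 + q)" by (simp add: p_def)
  have pt: "1 + p + p\<^sup>2 = of_real t" by (simp add: p_def t_def)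
  obtain \<omega> g1 g2 g3 g4 c1 c2 c3 c4 where \<omega>: "schwarz_function \<omega>"
    and c: "c1 = fps_expansion \<omega> 0 $ 1" "c2 = fps_expansion \<omega> 0 $ 2"
      "c3 = fps_expansion \<omega> 0 $ 3" "c4 = fps_expansion \<omega> 0 $ 4"
    and rec: "(1 + p) * a 2 = a 2 + g1"
      "(1 + p + p\<^sup>2) * a 3 = a 3 + g1 * a 2 + g2"
      "(1 + p) * (1 + p\<^sup>2) * a 4 = a 4 + g1 * a 3 + g2 * a 2 + g3"
      "(1 + p + p\<^sup>2 + p ^ 3 + p ^ 4) * a 5 = a 5 + g1 * a 4 + g2 * a 3 + g3 * a 2 + g4"
      "2 * (2 * g1) + (1 - p) * c1 = 2 * c1"
      "2 * (2 * g2 + g1\<^sup>2) + (1 - p) * (c1 * (2 * g1) + c2) = 2 * c2"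
      "2 * (2 * g3 + 2 * g1 * g2) + (1 - p) * (c1 * (2 * g2 + g1\<^sup>2) + c2 * (2 * g1) + c3) = 2 * c3"
      "2 * (2 * g4 + 2 * g1 * g3 + g2\<^sup>2)
        + (1 - p) * (c1 * (2 * g3 + 2 * g1 * g2) + c2 * (2 * g2 + g1\<^sup>2) + c3 * (2 * g1) + c4) = 2 * c4"
    by (rule class_SL_coeff_recurrences[OF assms, folded p_def])
  have k: "4 * (1 + p + p\<^sup>2) * of_real k = p\<^sup>2 * (1 + p)"
  proof -
    have "4 * t * k = q\<^sup>2 * (1 + q)" using t0 by (simp add: k_def)
    from arg_cong[OF this, of complex_of_real] show ?thesis unfolding pt by (simp add: p_def)
  qed
  have \<rho>: "of_real \<rho> * ((1 + p)\<^sup>2 * (1 + p\<^sup>2)) = (1 + p + p\<^sup>2)\<^sup>2"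
  proof -
    have "\<rho> * ((1 + q)\<^sup>2 * (1 + q\<^sup>2)) = t\<^sup>2"
      using nonzero_eq_divide_eq[OF less_imp_neq[OF den, THEN not_sym]] \<rho>_def by blast
    from arg_cong[OF this, of complex_of_real] show ?thesis unfolding pt by (simp add: p_def)
  qed
  have p1: "1 + p \<noteq> 0" "1 + p + p\<^sup>2 \<noteq> 0"
    unfolding pt unfolding pq of_real_eq_0_iff using q t0 by simp_all
  have coerced: "of_real \<beta> = (7 - p) / 8" "of_real \<alpha> = (p - 6) / 4"
    "of_real \<gamma> = (18 - 5 * p + p\<^sup>2) / 32" "of_real d1 = (p - 5) / 8" "of_real d2 = (p - 3) / 2 - of_real k"
    "of_real d3 = (49 - 26 * p + 5 * p\<^sup>2) / 32 + of_real k * (6 - p) / 4"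
    "of_real d4 = (- 193 + 135 * p - 47 * p\<^sup>2 + 9 * p ^ 3) / 512 - of_real k * (18 - 5 * p + p\<^sup>2) / 32"
    by (simp_all add: p_def \<beta>_def \<alpha>_def \<gamma>_def d1_def d2_def d3_def d4_def)
  \<comment> \<open>This is \<open>\<rho> * v2 * v4 - v3\<^sup>2\<close> with its coefficients
    written as images of real constants, the form required by \<open>functional_bound\<close>;
    \<open>coerced\<close> translates it into the form of \<open>hankel_reduction\<close>.\<close>
  let ?\<Phi> = "of_real \<rho> * (c2 - of_real \<beta> * c1\<^sup>2)
       * (c4 + of_real d1 * c2\<^sup>2 + of_real d2 * c1 * c3 + of_real d3 * c1\<^sup>2 * c2 + of_real d4 * c1 ^ 4)
     - (c3 + of_real \<alpha> * c1 * c2 + of_real \<gamma> * c1 ^ 3)\<^sup>2"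
  have eq: "16 * p\<^sup>2 * (1 + p + p\<^sup>2)\<^sup>2 * hankel_3_1 a = (1 + p)\<^sup>2 * ?\<Phi>"
    unfolding coerced by (rule hankel_reduction[OF p1 rec k \<rho>])
  obtain c x y w where S: "norm c \<le> 1" "norm x \<le> 1" "norm y \<le> 1" "norm w \<le> 1"
    "c1 = c" "c2 = (1 - c * cnj c) * x"
    "c3 = (1 - c * cnj c) * ((1 - x * cnj x) * y - cnj c * x\<^sup>2)"
    "c4 = (1 - c * cnj c) *
       ((1 - x * cnj x) * ((1 - y * cnj y) * w - cnj x * y\<^sup>2)
        - 2 * cnj c * (1 - x * cnj x) * x * y + (cnj c)\<^sup>2 * x ^ 3)"
    by (rule schwarz_coeffs[OF \<omega>, folded c])
  have "norm ?\<Phi> \<le> 1"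
    unfolding S(5)
    by (rule functional_bound[OF S(1-4,6-8)])
       (use sl_constant_bounds[OF q] in \<open>simp_all only: const_defs\<close>)
  then have "norm ((1 + p)\<^sup>2 * ?\<Phi>) \<le> (1 + q)\<^sup>2 * 1"
    unfolding norm_mult norm_power pq norm_of_real using q by (intro mult_mono) simp_all
  moreover have "norm (16 * p\<^sup>2 * (1 + p + p\<^sup>2)\<^sup>2 * hankel_3_1 a) = 16 * q\<^sup>2 * t\<^sup>2 * norm (hankel_3_1 a)"
    unfolding pt using q t0 by (simp add: norm_mult norm_power p_def)
  ultimately have "16 * q\<^sup>2 * t\<^sup>2 * norm (hankel_3_1 a) \<le> (1 + q)\<^sup>2"
    unfolding eq by simp
  moreover have "0 < 16 * q\<^sup>2 * t\<^sup>2" using q t0 by simp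
  ultimately show ?thesis
    unfolding t_def[symmetric] by (simp add: field_simps)
qed

end
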